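(* Let $f_1,\dots,f_m:\mathbb{R}^n\to\mathbb{R}$ be convex and lower semicontinuous, and assume that $F=(f_1,\dots,f_m)^\top$ satisfies Assumption (R). Let $\alpha\ge3$, $\beta_1>0$, and let $\{x_k\}$ be a bounded sequence generated by (MIPP) with initial point $x_0=x_1\in\mathbb{R}^n$. Suppose that one of the following two conditions holds: (a) each $f_i$, $i\in[m]$, is continuous; (b) $F^\infty:=(f_1^\infty,\dots,f_m^\infty)^\top\in F(\mathcal P)$, where $f_i^\infty:=\lim_{k\to\infty}f_i(x_k)$. Then there is a point $x^*\in\mathbb{R}^n$ such that $x_k\to x^*$ as $k\to\infty$.
   Context: Notation: $[m]=\{1,\dots,m\}$; inequalities between vectors are componentwise. A point $x^*$ is weakly Pareto optimal if there is no $y$ with $f_i(y)<f_i(x^* )$ for all $i\in[m]$; $\mathcal P_w$ is the set of such points. A point $x^*$ is Pareto optimal if there is no $y$ with $F(y)\le F(x^* )$ and $F(y)\ne F(x^* )$; $\mathcal P$ is the set of such points. $\mathcal L(F,a):=\{x:F(x)\le a\}$ and $\mathcal{LP}_w(F,a):=\mathcal P_w\cap\mathcal L(F,a)$. Assumption (R): for every $y_0\in\mathbb{R}^n$, the set $\mathcal{LP}_w(F,F(y_0))$ is nonempty and $$\mathbf R(y_0):=\sup_{F^*\in F(\mathcal{LP}_w(F,F(y_0)))}\ \inf_{z\in F^{-1}(F^* )}\tfrac12\|z-y_0\|^2<+\infty .$$ (MIPP): given $\alpha\ge3$, $\beta_1>0$, $x_0=x_1\in\mathbb{R}^n$, for all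 $k\ge1$ (no stopping criterion, so the sequence is infinite) set $$\lambda_k=\frac{k\beta_k}{k+\alpha-1},\quad y_k=x_k+\frac{k-1}{k+\alpha-1}(x_k-x_{k-1}),\quad x_{k+1}=\operatorname*{argmin}_{z\in\mathbb{R}^n}\Bigl\{\max_{i\in[m]}(f_i(z)-f_i(x_k))+\frac{1}{2\lambda_k}\|z-y_k\|^2\Bigr\},$$ $$\beta_{k+1}=\frac{k(k+\alpha-1)}{(k+1)^2}\beta_k .$$ *)

theory Defs
  imports "HOL-Analysis.Analysis"
begin

text \<open>
  The objectives \<open>f\<^sub>1, \<dots>, f\<^sub>m\<close> are the components of a single map \<open>F :: real^'n \<Rightarrow> real^'m\<close>;
  \<open>\<le>\<close> on \<open>real^'m\<close> is the componentwise order. In contrast, \<open><\<close> on that type means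
  ``\<open>\<le>\<close> and not \<open>\<ge>\<close>'' rather than strict inequality in every component, so
  strict inequalities are written out by components.
\<close>

definition lower_semicontinuous :: "('a::topological_space \<Rightarrow> real) \<Rightarrow> bool" where
  "lower_semicontinuous g \<longleftrightarrow> (\<forall>x. \<forall>c < g x. \<forall>\<^sub>F y in nhds x. c < g y)"

definition weak_pareto :: "(real^'n \<Rightarrow> real^'m) \<Rightarrow> (real^'n) set" where
  "weak_pareto F = {x. \<not> (\<exists>y. \<forall>i. F y $ i < F x $ i)}"

definition pareto :: "(real^'n \<Rightarrow> real^'m) \<Rightarrow> (real^'n) set" where
  "pareto F = {x. \<not> (\<exists>y. F y \<le> F x \<and> F y \<noteq> F x)}"

definition level_set :: "(real^'n \<Rightarrow> real^'m) \<Rightarrow> real^'m \<Rightarrow> (real^'n) set" where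
  "level_set F a = {x. F x \<le> a}"

definition weak_pareto_level :: "(real^'n \<Rightarrow> real^'m) \<Rightarrow> real^'m \<Rightarrow> (real^'n) set" where
  "weak_pareto_level F a = weak_pareto F \<inter> level_set F a"

text \<open>The supremum is taken in the extended reals, so that its finiteness is a genuine condition.\<close>

definition R_bound :: "(real^'n \<Rightarrow> real^'m) \<Rightarrow> real^'n \<Rightarrow> ereal" where
  "R_bound F y\<^sub>0 =
     (SUP F' \<in> F ` weak_pareto_level F (F y\<^sub>0).
        INF z \<in> F -` {F'}. ereal (1 / 2 * (norm (z - y\<^sub>0))\<^sup>2))"

definition assumption_R :: "(real^'n \<Rightarrow> real^'m) \<Rightarrow> bool" where
  "assumption_R F \<longleftrightarrow>
     (\<forall>y\<^sub>0. weak_pareto_level F (F y\<^sub>0) \<noteq> {} \<and> R_bound F y\<^sub>0 < \<infinity>)"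

definition mipp_lambda :: "real \<Rightarrow> (nat \<Rightarrow> real) \<Rightarrow> nat \<Rightarrow> real" where
  "mipp_lambda \<alpha> \<beta> k = real k * \<beta> k / (real k + \<alpha> - 1)"

definition mipp_y :: "real \<Rightarrow> (nat \<Rightarrow> real^'n) \<Rightarrow> nat \<Rightarrow> real^'n" where
  "mipp_y \<alpha> x k = x k + ((real k - 1) / (real k + \<alpha> - 1)) *\<^sub>R (x k - x (k - 1))"

definition mipp_objective ::
  "(real^'n \<Rightarrow> real^'m) \<Rightarrow> real \<Rightarrow> (nat \<Rightarrow> real) \<Rightarrow> (nat \<Rightarrow> real^'n) \<Rightarrow> nat \<Rightarrow> real^'n \<Rightarrow> real" where
  "mipp_objective F \<alpha> \<beta> x k z =
     (MAX i. F z $ i - F (x k) $ i)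
       + 1 / (2 * mipp_lambda \<alpha> \<beta> k) * (norm (z - mipp_y \<alpha> x k))\<^sup>2"

text \<open>Only \<open>\<beta> k\<close> with \<open>k \<ge> 1\<close> is constrained; the value \<open>\<beta> 0\<close> is never used.\<close>

definition mipp ::
  "(real^'n \<Rightarrow> real^'m) \<Rightarrow> real \<Rightarrow> (nat \<Rightarrow> real) \<Rightarrow> (nat \<Rightarrow> real^'n) \<Rightarrow> bool" where
  "mipp F \<alpha> \<beta> x \<longleftrightarrow>
     x 0 = x 1 \<and>
     (\<forall>k\<ge>1. is_arg_min (mipp_objective F \<alpha> \<beta> x k) (\<lambda>_. True) (x (k + 1)) \<and>
            \<beta> (k + 1) = real k * (real k + \<alpha> - 1) / (real k + 1)\<^sup>2 * \<beta> k)"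

end

theory Submission
  imports Defs
begin

text \<open>
  A finite convex function on \<open>\<real>\<^sup>n\<close> is continuous. Write
  \<open>M(u,v) = max\<^sub>i (F\<^sub>i u - F\<^sub>i v)\<close>. For every reference point \<open>z\<close>, the scheme is tuned so that
  \<open>E\<^sub>k(z) = \<bar>(k - 1)(x\<^sub>k - x\<^sub>k\<^sub>-\<^sub>1) + (\<alpha> - 1)(x\<^sub>k - z)\<bar>\<^sup>2 / 2 - k\<^sup>2 \<beta>\<^sub>k M(z, x\<^sub>k)\<close> is nonincreasing.
  Taking \<open>z = x\<^sub>k\<close> bounds \<open>k \<bar>x\<^sub>k\<^sub>+\<^sub>1 - x\<^sub>k\<bar>\<close>, and then the decrease of
  \<open>F\<^sub>i(x\<^sub>k\<^sub>+\<^sub>1) + \<bar>x\<^sub>k\<^sub>+\<^sub>1 - x\<^sub>k\<bar>\<^sup>2 / (2 \<lambda>\<^sub>k)\<close> makes \<open>F(x\<^sub>k)\<close> converge to some \<open>L\<close> and keeps \<open>E\<^sub>k(z)\<close> bounded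
  below whenever \<open>F z = L\<close>. If \<open>u, v\<close> are cluster points of \<open>x\<close>, the convergence of
  \<open>E\<^sub>k(u) - E\<^sub>k(v)\<close>, an affine expression in \<open>x\<close>, forces \<open>\<langle>x\<^sub>k, v - u\<rangle>\<close> to converge, so
  \<open>\<langle>u, v - u\<rangle> = \<langle>v, v - u\<rangle>\<close> and \<open>u = v\<close>.
\<close>

section \<open>Two convergence criteria for sequences\<close>

lemma convergent_if_unique_cluster_point:
  fixes X :: "nat \<Rightarrow> 'a::heine_borel"
  assumes bdd: "bounded (range X)"
    and unique: "\<And>r s u v. strict_mono r \<Longrightarrow> strict_mono s \<Longrightarrow>
      (X \<circ> r) \<longlonglongrightarrow> u \<Longrightarrow> (X \<circ> s) \<longlonglongrightarrow> v \<Longrightarrow> u = v"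
  shows "convergent X"
proof -
  obtain u r where r: "strict_mono r" "(X \<circ> r) \<longlonglongrightarrow> u"
    using bounded_imp_convergent_subsequence[OF bdd] by blast
  have "X \<longlonglongrightarrow> u"
  proof (rule ccontr)
    assume "\<not> X \<longlonglongrightarrow> u"
    then obtain e where e: "e > 0" "\<exists>\<^sub>F n in sequentially. dist (X n) u \<ge> e"
      by (auto simp: tendsto_iff not_eventually not_less)
    then have "infinite {n. dist (X n) u \<ge> e}"
      by (simp add: frequently_cofinite flip: cofinite_eq_sequentially)
    then obtain s :: "nat \<Rightarrow> nat" where s: "strict_mono s" "\<And>n. dist (X (s n)) u \<ge> e"
      using infinite_enumerate[of "{n. dist (X n) u \<ge> e}"] by auto
    have "bounded (range (X \<circ> s))"
      using bdd by (rule bounded_subset) auto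
    then obtain v t where t: "strict_mono t" "(X \<circ> s \<circ> t) \<longlonglongrightarrow> v"
      using bounded_imp_convergent_subsequence by blast
    then have "(X \<circ> (s \<circ> t)) \<longlonglongrightarrow> u"
      using unique[OF r(1) strict_mono_o[OF s(1) t(1)] r(2)] by (simp add: o_assoc)
    then have "\<forall>\<^sub>F n in sequentially. dist (X (s (t n))) u < e"
      using e(1) by (auto simp: tendsto_iff)
    then show False
      using s(2) by (simp add: not_less[symmetric] eventually_False)
  qed
  then show ?thesis
    by (auto simp: convergent_def)
qed

text \<open>A discrete counterpart of: if \<open>t y' + c y\<close> converges to zero and \<open>c > 0\<close>, so does \<open>y\<close>.\<close>

lemma tendsto_zero_from_increments:
  fixes r :: "nat \<Rightarrow> real"
  assumes lim: "(\<lambda>n. real n * (r (Suc n) - r n) + c * r (Suc n)) \<longlonglongrightarrow> 0" and "c \<ge> 1"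
  shows "r \<longlonglongrightarrow> 0"
proof (rule LIMSEQ_I)
  fix e :: real
  assume "e > 0"
  then obtain N where N: "\<And>n. n \<ge> N \<Longrightarrow> \<bar>real n * (r (Suc n) - r n) + c * r (Suc n)\<bar> < e / 2"
    using LIMSEQ_D[OF lim, of "e / 2"] by auto
  define K where "K = real N * \<bar>r N\<bar>"
  have "K \<ge> 0"
    by (simp add: K_def)
  \<comment> \<open>From \<open>N\<close> on, \<open>real n * (\<bar>r n\<bar> - e / 2)\<close> is
    nonincreasing: \<open>(real n + c) * r (Suc n)\<close> is \<open>real n * r n\<close> up to an
    error below \<open>e / 2\<close>, and \<open>c \<ge> 1\<close> lets \<open>real n + 1\<close>
    replace \<open>real n + c\<close>.\<close>
  have bound: "real n * (\<bar>r n\<bar> - e / 2) \<le> K" if "n \<ge> N" for n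
    using that
  proof (induction n rule: dec_induct)
    case base
    show ?case
      using \<open>e > 0\<close> by (simp add: K_def mult_left_mono)
  next
    case (step n)
    have "(real n + c) * \<bar>r (Suc n)\<bar> = \<bar>real n * r n + (real n * (r (Suc n) - r n) + c * r (Suc n))\<bar>"
    proof -
      have "(real n + c) * \<bar>r (Suc n)\<bar> = \<bar>(real n + c) * r (Suc n)\<bar>"
        using \<open>c \<ge> 1\<close> by (simp add: abs_mult)
      then show ?thesis
        by (simp add: algebra_simps)
    qed
    also have "\<dots> \<le> \<bar>real n * r n\<bar> + \<bar>real n * (r (Suc n) - r n) + c * r (Suc n)\<bar>"
      by (rule abs_triangle_ineq)
    also have "\<dots> \<le> real n * \<bar>r n\<bar> + e / 2"
      using N[of n] step.hyps by (simp only: abs_mult abs_of_nat add_left_mono less_imp_le)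
    finally have "(real n + c) * \<bar>r (Suc n)\<bar> \<le> real n * \<bar>r n\<bar> + e / 2" .
    moreover have "(real n + 1) * \<bar>r (Suc n)\<bar> \<le> (real n + c) * \<bar>r (Suc n)\<bar>"
      using \<open>c \<ge> 1\<close> by (intro mult_right_mono) auto
    ultimately show ?case
      using step.IH by (simp add: algebra_simps add_divide_distrib)
  qed
  obtain m :: nat where m: "K / (e / 2) < real m"
    using reals_Archimedean2 by blast
  show "\<exists>no. \<forall>n\<ge>no. norm (r n - 0) < e"
  proof (intro exI allI impI)
    fix n
    assume n: "n \<ge> max (max N m) 1"
    then have "K < real n * (e / 2)"
      using m \<open>e > 0\<close> by (simp add: field_simps) (smt (verit) mult_left_mono of_nat_le_iff)
    then have "real n * (\<bar>r n\<bar> - e / 2) < real n * (e / 2)"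
      using bound[of n] n by linarith
    then have "\<bar>r n\<bar> - e / 2 < e / 2"
      using n by (subst (asm) mult_less_cancel_left_pos) auto
    then show "norm (r n - 0) < e"
      by simp
  qed
qed

lemma tendsto_from_increments:
  fixes s :: "nat \<Rightarrow> real"
  assumes lim: "(\<lambda>n. real n * (s (Suc n) - s n) + c * s (Suc n)) \<longlonglongrightarrow> l" and "c \<ge> 1"
  shows "s \<longlonglongrightarrow> l / c"
proof -
  have "(\<lambda>n. (real n * (s (Suc n) - s n) + c * s (Suc n)) - l) \<longlonglongrightarrow> 0"
    using tendsto_diff[OF lim tendsto_const[of l]] by simp
  then have "(\<lambda>n. real n * ((s (Suc n) - l / c) - (s n - l / c)) + c * (s (Suc n) - l / c)) \<longlonglongrightarrow> 0"
    using \<open>c \<ge> 1\<close> by (simp add: algebra_simps)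
  then have "(\<lambda>n. s n - l / c) \<longlonglongrightarrow> 0"
    using \<open>c \<ge> 1\<close> by (rule tendsto_zero_from_increments)
  then show ?thesis
    by (simp add: LIM_zero_iff)
qed

section \<open>The proximal step and the merit function\<close>

text \<open>This is the optimality condition saying that \<open>(y - p) / \<mu>\<close> is a
  subgradient of \<open>h\<close> at \<open>p\<close>. It is obtained directly by comparing
  \<open>p\<close> with the points \<open>(1 - t) p + t z\<close> of the segment to
  \<open>z\<close>, dividing by \<open>t\<close> and letting \<open>t\<close> tend to 0.\<close>

lemma prox_inequality:
  fixes h :: "'a::real_inner \<Rightarrow> real"
  assumes conv: "convex_on UNIV h" and "\<mu> > 0"
    and min: "\<And>z. h p + 1 / (2 * \<mu>) * (norm (p - y))\<^sup>2 \<le> h z + 1 / (2 * \<mu>) * (norm (z - y))\<^sup>2"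
  shows "\<mu> * (h p - h z) \<le> inner (p - y) (z - p)"
proof -
  define c where "c = inner (p - y) (z - p)"
  define d where "d = (norm (z - p))\<^sup>2"
  have le: "\<mu> * (h p - h z) \<le> c + t * (d / 2)" if t: "0 < t" "t < 1" for t
  proof -
    define w where "w = (1 - t) *\<^sub>R p + t *\<^sub>R z"
    have "h w \<le> (1 - t) * h p + t * h z"
      unfolding w_def using t by (intro convex_onD[OF conv]) auto
    moreover have "w - y = (p - y) + t *\<^sub>R (z - p)"
      by (simp add: w_def algebra_simps)
    then have "(norm (w - y))\<^sup>2 = (norm (p - y))\<^sup>2 + 2 * t * c + t\<^sup>2 * d"
      by (simp only: c_def d_def power2_norm_eq_inner)
        (simp add: inner_add_left inner_add_right inner_commute power2_eq_square algebra_simps)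
    ultimately have "h p + 1 / (2 * \<mu>) * (norm (p - y))\<^sup>2
        \<le> (1 - t) * h p + t * h z + 1 / (2 * \<mu>) * ((norm (p - y))\<^sup>2 + 2 * t * c + t\<^sup>2 * d)"
      using min[of w] by simp
    then have "t * (h p - h z) \<le> 1 / (2 * \<mu>) * (2 * t * c + t\<^sup>2 * d)"
      by (simp add: algebra_simps)
    then have "t * (\<mu> * (h p - h z)) \<le> t * (c + t * (d / 2))"
      using \<open>\<mu> > 0\<close> by (simp add: field_simps power2_eq_square)
    then show ?thesis
      using t(1) by simp
  qed
  have "((\<lambda>t. c + t * (d / 2)) \<longlongrightarrow> c + 0 * (d / 2)) (at_right 0)"
    by (intro tendsto_intros)
  moreover have "\<forall>\<^sub>F t in at_right (0::real). \<mu> * (h p - h z) \<le> c + t * (d / 2)"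
    using le eventually_at_right_less[of 0] eventually_at_right_field[of _ 0]
    by (metis (mono_tags, lifting) zero_less_one)
  ultimately have "\<mu> * (h p - h z) \<le> c + 0 * (d / 2)"
    using tendsto_lowerbound trivial_limit_at_right_real by blast
  then show ?thesis
    by (simp add: c_def)
qed

definition max_gap :: "('a \<Rightarrow> real^'m) \<Rightarrow> 'a \<Rightarrow> 'a \<Rightarrow> real" where
  "max_gap F u v = (MAX i. F u $ i - F v $ i)"

lemma max_gap_ge: "F u $ i - F v $ i \<le> max_gap F u v"
  by (simp add: max_gap_def)

lemma max_gap_attained:
  obtains i where "max_gap F u v = F u $ i - F v $ i"
proof -
  have "max_gap F u v \<in> range (\<lambda>i. F u $ i - F v $ i)"
    unfolding max_gap_def by (rule Max_in) auto
  then show ?thesis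
    using that by blast
qed

lemma max_gap_self [simp]: "max_gap F u u = 0"
  by (simp add: max_gap_def)

text \<open>Split the difference in a component attaining the left side. This inequality stands in
  for the additivity of differences that holds for a single objective.\<close>

lemma max_gap_triangle: "max_gap F u w \<le> max_gap F u v + max_gap F v w"
  by (rule max_gap_attained[of F u w]) (smt (verit) max_gap_ge)

lemma max_gap_cong: "F u = F u' \<Longrightarrow> max_gap F u v = max_gap F u' v"
  by (simp add: max_gap_def)

lemma convex_on_max_gap:
  fixes F :: "'a::real_vector \<Rightarrow> real^'m"
  assumes "\<And>i. convex_on UNIV (\<lambda>z. F z $ i)"
  shows "convex_on UNIV (\<lambda>z. max_gap F z v)"
proof (rule convex_onI)
  fix t :: real and a b :: 'a
  assume t: "0 < t" "t < 1"
  define w where "w = (1 - t) *\<^sub>R a + t *\<^sub>R b"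
  obtain i where i: "max_gap F w v = F w $ i - F v $ i"
    by (rule max_gap_attained)
  have "F w $ i \<le> (1 - t) * F a $ i + t * F b $ i"
    unfolding w_def using t by (intro convex_onD[OF assms]) auto
  then have "max_gap F w v \<le> (1 - t) * (F a $ i - F v $ i) + t * (F b $ i - F v $ i)"
    unfolding i by (simp add: algebra_simps)
  also have "\<dots> \<le> (1 - t) * max_gap F a v + t * max_gap F b v"
    using t by (intro add_mono mult_left_mono max_gap_ge) auto
  finally show "max_gap F ((1 - t) *\<^sub>R a + t *\<^sub>R b) v \<le> (1 - t) * max_gap F a v + t * max_gap F b v"
    unfolding w_def .
qed simp

section \<open>The iteration, its energy and its step sizes\<close>

locale mipp_sequence =
  fixes F :: "real^'n \<Rightarrow> real^'m"
    and \<alpha> :: real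
    and \<beta> :: "nat \<Rightarrow> real"
    and x :: "nat \<Rightarrow> real^'n"
  assumes convex_F: "\<And>i. convex_on UNIV (\<lambda>z. F z $ i)"
    and alpha_ge: "\<alpha> \<ge> 3"
    and beta_1_pos: "\<beta> 1 > 0"
    and mipp: "mipp F \<alpha> \<beta> x"
    and bounded_x: "bounded (range x)"
begin

abbreviation "\<mu> \<equiv> mipp_lambda \<alpha> \<beta>"
abbreviation "y \<equiv> mipp_y \<alpha> x"

text \<open>The discrete counterpart of \<open>t x'(t) + (\<alpha> - 1) (x(t) - z)\<close>, the
  vector used in Lyapunov functions for inertial dynamics with damping
  \<open>\<alpha> / t\<close>.\<close>

definition velocity :: "nat \<Rightarrow> real^'n \<Rightarrow> real^'n" where
  "velocity k z = (real k - 1) *\<^sub>R (x k - x (k - 1)) + (\<alpha> - 1) *\<^sub>R (x k - z)"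

definition energy :: "nat \<Rightarrow> real^'n \<Rightarrow> real" where
  "energy k z = (norm (velocity k z))\<^sup>2 / 2 - (real k)\<^sup>2 * \<beta> k * max_gap F z (x k)"

lemma beta_Suc:
  "k \<ge> 1 \<Longrightarrow> \<beta> (Suc k) = real k * (real k + \<alpha> - 1) / (real k + 1)\<^sup>2 * \<beta> k"
  using mipp by (simp add: mipp_def)

lemma beta_pos: "k \<ge> 1 \<Longrightarrow> \<beta> k > 0"
proof (induction k rule: nat_induct_at_least)
  case base
  show ?case by (rule beta_1_pos)
next
  case (Suc k)
  then show ?case
    using alpha_ge by (auto simp: beta_Suc intro!: divide_pos_pos mult_pos_pos)
qed

lemma lambda_pos: "k \<ge> 1 \<Longrightarrow> \<mu> k > 0"
  using beta_pos[of k] alpha_ge by (simp add: mipp_lambda_def)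

lemma lambda_beta:
  assumes "k \<ge> 1"
  shows "(real k + \<alpha> - 1) * \<mu> k = real k * \<beta> k"
  using assms alpha_ge by (simp add: mipp_lambda_def)

text \<open>The recursion for \<open>\<beta>\<close> is designed for this identity: the right side
  is the factor of the new gap produced by the estimate in \<open>energy_Suc_le\<close>.\<close>

lemma energy_weight_Suc:
  assumes "k \<ge> 1"
  shows "(real (Suc k))\<^sup>2 * \<beta> (Suc k) = (real k + \<alpha> - 1)\<^sup>2 * \<mu> k"
proof -
  have "(real (Suc k))\<^sup>2 * \<beta> (Suc k) = (real k + \<alpha> - 1) * (real k * \<beta> k)"
    using assms by (simp add: beta_Suc add.commute)
  then show ?thesis
    using lambda_beta[OF assms] by (simp add: power2_eq_square)
qed

lemma lambda_Suc:
  assumes "k \<ge> 1"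
  shows "(real k + \<alpha>) * (real k + 1) * \<mu> (Suc k) = (real k + \<alpha> - 1)\<^sup>2 * \<mu> k"
proof -
  have "(real k + \<alpha>) * \<mu> (Suc k) = (real k + 1) * \<beta> (Suc k)"
    using lambda_beta[of "Suc k"] by (simp add: algebra_simps)
  then have "(real k + 1) * ((real k + \<alpha>) * \<mu> (Suc k)) = (real (Suc k))\<^sup>2 * \<beta> (Suc k)"
    by (simp add: power2_eq_square add.commute)
  then show ?thesis
    using energy_weight_Suc[OF assms] by (simp add: mult.left_commute mult.assoc)
qed

text \<open>By \<open>lambda_Suc\<close> the ratio of consecutive step sizes is
  \<open>(k + \<alpha> - 1)^2 / ((k + \<alpha>) (k + 1))\<close>, which is at least 1 because
  \<open>\<alpha> \<ge> 3\<close>.\<close>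

lemma lambda_le_Suc:
  assumes "k \<ge> 1"
  shows "\<mu> k \<le> \<mu> (Suc k)"
proof -
  have pos: "(real k + \<alpha>) * (real k + 1) > 0"
    using alpha_ge by simp
  have "(real k + \<alpha> - 1)\<^sup>2 - (real k + \<alpha>) * (real k + 1) = real k * (\<alpha> - 3) + (\<alpha> * (\<alpha> - 3) + 1)"
    by (simp add: power2_eq_square algebra_simps)
  also have "\<dots> \<ge> 0"
    using alpha_ge by simp
  finally have "(real k + \<alpha>) * (real k + 1) * \<mu> k \<le> (real k + \<alpha> - 1)\<^sup>2 * \<mu> k"
    using lambda_pos[OF assms] by (intro mult_right_mono) auto
  then show ?thesis
    unfolding lambda_Suc[OF assms, symmetric] using pos by (simp only: mult_le_cancel_left_pos)
qed

lemma lambda_ge: "k \<ge> 1 \<Longrightarrow> \<mu> 1 \<le> \<mu> k"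
  by (induction k rule: nat_induct_at_least) (use lambda_le_Suc in \<open>auto intro: order_trans\<close>)

section \<open>Monotonicity of the energy\<close>

lemma mipp_prox_inequality:
  assumes "k \<ge> 1"
  shows "\<mu> k * (max_gap F (x (Suc k)) (x k) - max_gap F z (x k))
    \<le> inner (x (Suc k) - y k) (z - x (Suc k))"
proof (rule prox_inequality[where h = "\<lambda>z. max_gap F z (x k)"])
  show "convex_on UNIV (\<lambda>z. max_gap F z (x k))"
    by (rule convex_on_max_gap[OF convex_F])
  show "\<mu> k > 0"
    by (rule lambda_pos[OF assms])
  have "is_arg_min (mipp_objective F \<alpha> \<beta> x k) (\<lambda>_. True) (x (Suc k))"
    using mipp assms by (simp add: mipp_def)
  then show "max_gap F (x (Suc k)) (x k) + 1 / (2 * \<mu> k) * (norm (x (Suc k) - y k))\<^sup>2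
      \<le> max_gap F z (x k) + 1 / (2 * \<mu> k) * (norm (z - y k))\<^sup>2" for z
    by (auto simp: is_arg_min_linorder mipp_objective_def max_gap_def)
qed

lemma energy_Suc_le:
  assumes "k \<ge> 1"
  shows "energy (Suc k) z \<le> energy k z"
proof -
  define c where "c = real k + \<alpha> - 1"
  define p where "p = x (Suc k) - y k"
  define m where "m = max_gap F (x (Suc k)) (x k)"
  define M where "M = max_gap F z (x k)"
  define M' where "M' = max_gap F z (x (Suc k))"
  define v where "v = velocity k z"
  define v' where "v' = velocity (Suc k) z"
  have "c > 0"
    using alpha_ge assms by (simp add: c_def)
  have v': "v' = real k *\<^sub>R (x (Suc k) - x k) + (\<alpha> - 1) *\<^sub>R (x (Suc k) - z)"
    by (simp add: v'_def velocity_def)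
  have "c *\<^sub>R y k = c *\<^sub>R x k + (real k - 1) *\<^sub>R (x k - x (k - 1))"
    using \<open>c > 0\<close> by (simp add: mipp_y_def c_def scaleR_add_right)
  \<comment> \<open>The extrapolation in \<open>y k\<close> absorbs the old momentum, so the
    velocity changes by a multiple of the proximal residual alone.\<close>
  then have "v' - v = c *\<^sub>R p"
    by (simp add: v' v_def velocity_def p_def c_def algebra_simps)
  moreover have "(norm v')\<^sup>2 / 2 - (norm v)\<^sup>2 / 2 = inner (v' - v) v' - (norm (v' - v))\<^sup>2 / 2"
    by (simp add: power2_norm_eq_inner inner_diff_left inner_diff_right inner_commute algebra_simps
        diff_divide_distrib add_divide_distrib)
  ultimately have "(norm v')\<^sup>2 / 2 - (norm v)\<^sup>2 / 2 \<le> c * inner p v'"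
    by simp
  \<comment> \<open>\<open>v'\<close> combines the directions from \<open>x k\<close> and from
    \<open>z\<close> to the new iterate, so the proximal inequality is applied at both
    points.\<close>
  also have "inner p v' = - (real k * inner p (x k - x (Suc k)) + (\<alpha> - 1) * inner p (z - x (Suc k)))"
    by (simp add: v' inner_add_right inner_diff_right algebra_simps)
  also have "\<dots> \<le> - (real k * (\<mu> k * m) + (\<alpha> - 1) * (\<mu> k * (m - M)))"
    using mipp_prox_inequality[OF assms, of "x k"] mipp_prox_inequality[OF assms, of z] alpha_ge
    by (intro le_imp_neg_le add_mono mult_left_mono) (simp_all add: m_def M_def p_def)
  finally have "(norm v')\<^sup>2 / 2 - (norm v)\<^sup>2 / 2
      \<le> c * - (real k * (\<mu> k * m) + (\<alpha> - 1) * (\<mu> k * (m - M)))"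
    using \<open>c > 0\<close> by simp
  \<comment> \<open>The base point of the gap moves from \<open>x k\<close> to
    \<open>x (Suc k)\<close> by the triangle inequality.\<close>
  moreover have "(c\<^sup>2 * \<mu> k) * (M - m) \<le> (c\<^sup>2 * \<mu> k) * M'"
    using max_gap_triangle[of F z "x k" "x (Suc k)"] lambda_pos[OF assms]
    by (intro mult_left_mono) (simp_all add: M_def M'_def m_def)
  moreover have "c * - (real k * (\<mu> k * m) + (\<alpha> - 1) * (\<mu> k * (m - M)))
      = (c\<^sup>2 * \<mu> k) * (M - m) - real k * (c * \<mu> k) * M"
    by (simp add: c_def power2_eq_square algebra_simps)
  moreover have "real k * (c * \<mu> k) = (real k)\<^sup>2 * \<beta> k"
    using lambda_beta[OF assms] by (simp add: c_def power2_eq_square)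
  moreover have "c\<^sup>2 * \<mu> k = (real (Suc k))\<^sup>2 * \<beta> (Suc k)"
    using energy_weight_Suc[OF assms] by (simp add: c_def)
  ultimately have "(norm v')\<^sup>2 / 2 - (norm v)\<^sup>2 / 2
      \<le> (real (Suc k))\<^sup>2 * \<beta> (Suc k) * M' - (real k)\<^sup>2 * \<beta> k * M"
    by (smt (verit))
  then show ?thesis
    unfolding energy_def v_def v'_def M_def M'_def by linarith
qed

lemma energy_le_energy_1: "k \<ge> 1 \<Longrightarrow> energy k z \<le> energy 1 z"
  by (induction k rule: nat_induct_at_least) (use energy_Suc_le in \<open>auto intro: order_trans\<close>)

lemma continuous_F: "continuous_on A F"
proof -
  have "continuous_on UNIV (\<lambda>z. F z $ i)" for i
    by (rule convex_on_continuous[OF open_UNIV convex_F])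
  then have "continuous_on UNIV F"
    by (subst continuous_on_componentwise) (auto simp: Basis_vec_def inner_axis)
  then show ?thesis
    using continuous_on_subset by blast
qed

section \<open>Increment bounds and convergence of the objective values\<close>

lemma F_x_bounded_below: "\<exists>B. \<forall>k i. B \<le> F (x k) $ i"
proof -
  have "compact (F ` closure (range x))"
    using bounded_x by (intro compact_continuous_image continuous_F) simp
  then obtain B where B: "\<And>w. w \<in> F ` closure (range x) \<Longrightarrow> norm w \<le> B"
    using compact_imp_bounded bounded_iff by metis
  have "- B \<le> F (x k) $ i" for k i
    using B[of "F (x k)"] component_le_norm_cart[of "F (x k)" i] closure_subset[of "range x"]
    by force
  then show ?thesis
    by blast
qed

text \<open>The energy decreases for every reference point; comparing with the iterate itself makes
  the gap term vanish, whatever its sign elsewhere.\<close>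

lemma scaled_increment_bounded: "\<exists>C. \<forall>k. real k * norm (x (Suc k) - x k) \<le> C"
proof -
  obtain B where B: "\<And>k i. B \<le> F (x k) $ i"
    using F_x_bounded_below by blast
  obtain A where A: "\<And>k. norm (x k) \<le> A"
    using bounded_x by (auto simp: bounded_iff)
  define S where "S = (\<Sum>i\<in>UNIV. \<bar>F (x 1) $ i\<bar>)"
  \<comment> \<open>Bounds twice the initial energy uniformly over the reference points
    \<open>x (Suc k)\<close>; at index 1 the momentum part of the velocity has factor 0.\<close>
  define C where "C = ((\<alpha> - 1) * (2 * A))\<^sup>2 + 2 * \<beta> 1 * (S - B)"
  have "(real k * norm (x (Suc k) - x k))\<^sup>2 \<le> C" for k
  proof -
    obtain i where i: "max_gap F (x (Suc k)) (x 1) = F (x (Suc k)) $ i - F (x 1) $ i"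
      by (rule max_gap_attained)
    have "F (x 1) $ i \<le> S"
      unfolding S_def by (rule order_trans[OF abs_ge_self]) (rule member_le_sum, auto)
    then have "- max_gap F (x (Suc k)) (x 1) \<le> S - B"
      using B[of "Suc k" i] i by simp
    then have gap: "\<beta> 1 * (- max_gap F (x (Suc k)) (x 1)) \<le> \<beta> 1 * (S - B)"
      using beta_1_pos by (intro mult_left_mono) auto
    have "norm (velocity 1 (x (Suc k))) = (\<alpha> - 1) * norm (x 1 - x (Suc k))"
      using alpha_ge by (simp add: velocity_def)
    also have "\<dots> \<le> (\<alpha> - 1) * (2 * A)"
      using alpha_ge norm_triangle_ineq4[of "x 1" "x (Suc k)"] A[of 1] A[of "Suc k"]
      by (intro mult_left_mono) auto
    finally have "(norm (velocity 1 (x (Suc k))))\<^sup>2 \<le> ((\<alpha> - 1) * (2 * A))\<^sup>2"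
      by (intro power_mono) auto
    moreover have "energy (Suc k) (x (Suc k)) \<le> energy 1 (x (Suc k))"
      by (rule energy_le_energy_1) simp
    ultimately show ?thesis
      using gap by (simp add: energy_def C_def power_mult_distrib velocity_def[of "Suc k"])
  qed
  then have "real k * norm (x (Suc k) - x k) \<le> sqrt C" for k
    by (intro real_le_rsqrt) simp
  then show ?thesis
    by blast
qed

definition kinetic :: "nat \<Rightarrow> real" where
  "kinetic k = (norm (x (Suc k) - x k))\<^sup>2 / (2 * \<mu> k)"

text \<open>Increments are of order \<open>1 / k\<close>, while the step sizes stay above
  \<open>\<mu> 1\<close>.\<close>

lemma kinetic_tendsto_0: "kinetic \<longlonglongrightarrow> 0"
proof -
  obtain C where C: "\<And>k. real k * norm (x (Suc k) - x k) \<le> C"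
    using scaled_increment_bounded by blast
  have "(\<lambda>k. x (Suc k) - x k) \<longlonglongrightarrow> 0"
  proof (rule Lim_null_comparison)
    show "\<forall>\<^sub>F k in sequentially. norm (x (Suc k) - x k) \<le> C / real k"
      using eventually_gt_at_top[of 0]
      by eventually_elim (use C in \<open>simp add: field_simps\<close>)
    show "(\<lambda>k. C / real k) \<longlonglongrightarrow> 0"
      by (rule lim_const_over_n)
  qed
  then have "(\<lambda>k. (norm (x (Suc k) - x k))\<^sup>2 / (2 * \<mu> 1)) \<longlonglongrightarrow> (norm (0::real^'n))\<^sup>2 / (2 * \<mu> 1)"
    using lambda_pos[of 1] by (intro tendsto_intros) auto
  then have lim: "(\<lambda>k. (norm (x (Suc k) - x k))\<^sup>2 / (2 * \<mu> 1)) \<longlonglongrightarrow> 0"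
    by simp
  show ?thesis
  proof (rule Lim_null_comparison[OF _ lim])
    show "\<forall>\<^sub>F k in sequentially. norm (kinetic k) \<le> (norm (x (Suc k) - x k))\<^sup>2 / (2 * \<mu> 1)"
      using eventually_ge_at_top[of 1]
    proof eventually_elim
      case (elim k)
      then show ?case
        using lambda_pos[OF elim] lambda_pos[of 1] lambda_ge[OF elim]
        by (simp add: kinetic_def frac_le)
    qed
  qed
qed

text \<open>Apply the proximal inequality at the current iterate. The extrapolation factor
  \<open>g\<close> is at most 1 and the step sizes do not decrease, so inertia can add no more than
  the previous kinetic term.\<close>

lemma total_energy_Suc_le:
  assumes "k \<ge> 1"
  shows "F (x (Suc (Suc k))) $ i + kinetic (Suc k) \<le> F (x (Suc k)) $ i + kinetic k"
proof -
  define g where "g = real k / (real k + \<alpha>)"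
  define d where "d = x (Suc k) - x k"
  define d' where "d' = x (Suc (Suc k)) - x (Suc k)"
  define l where "l = \<mu> (Suc k)"
  have "l > 0" "\<mu> k > 0" "\<mu> k \<le> l"
    using lambda_pos assms lambda_le_Suc by (simp_all add: l_def)
  have "0 \<le> g" "g \<le> 1"
    using alpha_ge by (simp_all add: g_def)
  have step: "x (Suc (Suc k)) - y (Suc k) = d' - g *\<^sub>R d"
    by (simp add: mipp_y_def d'_def d_def g_def add.commute)
  have "l * max_gap F (x (Suc (Suc k))) (x (Suc k)) \<le> inner (d' - g *\<^sub>R d) (- d')"
    using mipp_prox_inequality[of "Suc k" "x (Suc k)"] unfolding step l_def by (simp add: d'_def)
  moreover have "l * (F (x (Suc (Suc k))) $ i - F (x (Suc k)) $ i)
      \<le> l * max_gap F (x (Suc (Suc k))) (x (Suc k))"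
    using \<open>l > 0\<close> by (intro mult_left_mono max_gap_ge) simp
  \<comment> \<open>Polarization; the last square is then dropped.\<close>
  moreover have "inner (d' - g *\<^sub>R d) (- d') = (g\<^sup>2 * (norm d)\<^sup>2 - (norm d')\<^sup>2 - (norm (d' - g *\<^sub>R d))\<^sup>2) / 2"
    by (simp only: power2_norm_eq_inner)
      (simp add: inner_diff_left inner_diff_right inner_commute power2_eq_square algebra_simps)
  moreover have "g\<^sup>2 * (norm d)\<^sup>2 \<le> 1 * (norm d)\<^sup>2"
    using \<open>0 \<le> g\<close> \<open>g \<le> 1\<close> by (intro mult_right_mono power_le_one) auto
  ultimately have "l * (F (x (Suc (Suc k))) $ i - F (x (Suc k)) $ i) \<le> ((norm d)\<^sup>2 - (norm d')\<^sup>2) / 2"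
    using zero_le_power2[of "norm (d' - g *\<^sub>R d)"] by argo
  then have "F (x (Suc (Suc k))) $ i - F (x (Suc k)) $ i \<le> (norm d)\<^sup>2 / (2 * l) - (norm d')\<^sup>2 / (2 * l)"
    using \<open>l > 0\<close> by (simp add: field_simps)
  moreover have "(norm d)\<^sup>2 / (2 * l) \<le> (norm d)\<^sup>2 / (2 * \<mu> k)"
    using \<open>\<mu> k > 0\<close> \<open>\<mu> k \<le> l\<close> by (intro divide_left_mono) auto
  ultimately show ?thesis
    by (simp add: kinetic_def d_def d'_def l_def)
qed

text \<open>The total energy decreases to a limit, which is also the limit of the objective values
  since the kinetic term vanishes. A decreasing sequence stays above its limit, hence the second
  conjunct.\<close>

lemma F_component_limit:
  "\<exists>L. (\<lambda>k. F (x k) $ i) \<longlonglongrightarrow> L \<and> (\<forall>k\<ge>1. L - kinetic k \<le> F (x (Suc k)) $ i)"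
proof -
  obtain B where B: "\<And>k i. B \<le> F (x k) $ i"
    using F_x_bounded_below by blast
  \<comment> \<open>The shift by one keeps to indices with positive step size, where the descent
    inequality is available.\<close>
  define W where "W = (\<lambda>k. F (x (Suc (Suc k))) $ i + kinetic (Suc k))"
  have "decseq W"
    unfolding W_def by (intro decseq_SucI total_energy_Suc_le) simp
  moreover have "B \<le> W k" for k
    using B[of "Suc (Suc k)" i] lambda_pos[of "Suc k"] by (simp add: W_def kinetic_def add_increasing2)
  ultimately obtain L where L: "W \<longlonglongrightarrow> L" "\<And>k. L \<le> W k"
    using decseq_convergent by metis
  have "(\<lambda>k. W k - kinetic (Suc k)) \<longlonglongrightarrow> L - 0"
    by (intro tendsto_diff L(1) LIMSEQ_Suc kinetic_tendsto_0)
  then have "(\<lambda>k. F (x (k + 2)) $ i) \<longlonglongrightarrow> L"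
    by (simp add: W_def)
  then have "(\<lambda>k. F (x k) $ i) \<longlonglongrightarrow> L"
    by (rule LIMSEQ_offset)
  moreover have "L - kinetic k \<le> F (x (Suc k)) $ i" if "k \<ge> 1" for k
    using L(2)[of "k - 1"] that by (simp add: W_def)
  ultimately show ?thesis
    by blast
qed

lemma F_limit:
  obtains L where "(\<lambda>k. F (x k)) \<longlonglongrightarrow> L" "\<And>k i. k \<ge> 1 \<Longrightarrow> L $ i - kinetic k \<le> F (x (Suc k)) $ i"
proof -
  obtain L where L: "\<And>i. (\<lambda>k. F (x k) $ i) \<longlonglongrightarrow> L i"
    "\<And>i k. k \<ge> 1 \<Longrightarrow> L i - kinetic k \<le> F (x (Suc k)) $ i"
    using F_component_limit by metis
  have "(\<lambda>k. F (x k)) \<longlonglongrightarrow> (\<chi> i. L i)"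
    using L(1) by (intro vec_tendstoI) simp
  then show ?thesis
    using that[of "\<chi> i. L i"] L(2) by simp
qed

section \<open>Convergence of the iterates\<close>

text \<open>The gap term may be negative, but only by \<open>kinetic k\<close>, whose weighted size is controlled
  by \<open>scaled_increment_bounded\<close>.\<close>

lemma energy_convergent:
  assumes z: "\<And>k i. k \<ge> 1 \<Longrightarrow> F z $ i - kinetic k \<le> F (x (Suc k)) $ i"
  shows "convergent (\<lambda>k. energy (Suc k) z)"
proof -
  obtain C where C: "\<And>k. real k * norm (x (Suc k) - x k) \<le> C"
    using scaled_increment_bounded by blast
  have "- ((\<alpha> * C)\<^sup>2 / 2) \<le> energy (Suc (Suc n)) z" for n
  proof -
    define k where "k = Suc n"
    have "k \<ge> 1"
      by (simp add: k_def)
    define w where "w = (real k + \<alpha> - 1)\<^sup>2 * \<mu> k"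
    have "w \<ge> 0"
      using lambda_pos[OF \<open>k \<ge> 1\<close>] by (simp add: w_def)
    have "max_gap F z (x (Suc k)) \<le> kinetic k"
      by (rule max_gap_attained[of F z "x (Suc k)"]) (metis z[OF \<open>k \<ge> 1\<close>] diff_le_eq add.commute)
    then have "w * max_gap F z (x (Suc k)) \<le> w * kinetic k"
      using \<open>w \<ge> 0\<close> by (rule mult_left_mono)
    \<comment> \<open>The step size in the weight cancels the one in \<open>kinetic k\<close>,
      leaving only the scaled increment.\<close>
    also have "\<dots> = ((real k + \<alpha> - 1) * norm (x (Suc k) - x k))\<^sup>2 / 2"
      using lambda_pos[OF \<open>k \<ge> 1\<close>] by (simp add: w_def kinetic_def power_mult_distrib)
    also have "\<dots> \<le> (\<alpha> * C)\<^sup>2 / 2"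
    proof (intro divide_right_mono power_mono)
      have "\<alpha> - 1 \<le> (\<alpha> - 1) * real k"
        using alpha_ge \<open>k \<ge> 1\<close> by simp
      then have "real k + \<alpha> - 1 \<le> \<alpha> * real k"
        by (simp add: algebra_simps)
      then have "(real k + \<alpha> - 1) * norm (x (Suc k) - x k) \<le> \<alpha> * real k * norm (x (Suc k) - x k)"
        by (rule mult_right_mono) simp
      also have "\<dots> \<le> \<alpha> * C"
        using C[of k] alpha_ge by (simp add: mult.assoc)
      finally show "(real k + \<alpha> - 1) * norm (x (Suc k) - x k) \<le> \<alpha> * C" .
    qed (use alpha_ge in auto)
    finally have "- ((\<alpha> * C)\<^sup>2 / 2) \<le> energy (Suc k) z"
      using zero_le_power2[of "norm (velocity (Suc k) z)"]
      unfolding energy_def energy_weight_Suc[OF \<open>k \<ge> 1\<close>] w_def by linarith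
    then show ?thesis
      by (simp add: k_def)
  qed
  moreover have "decseq (\<lambda>n. energy (Suc (Suc n)) z)"
    by (intro decseq_SucI energy_Suc_le) simp
  ultimately have "convergent (\<lambda>n. energy (Suc (Suc n)) z)"
    using decseq_convergent[of "\<lambda>n. energy (Suc (Suc n)) z"] by (metis convergent_def)
  then show ?thesis
    by (simp add: convergent_Suc_iff[of "\<lambda>n. energy (Suc n) z"])
qed

text \<open>For two reference points with the same objective values the gap terms cancel and the
  squared norms differ by an affine expression.\<close>

lemma inner_x_convergent:
  assumes "F u = F v"
    and u: "convergent (\<lambda>k. energy (Suc k) u)" and v: "convergent (\<lambda>k. energy (Suc k) v)"
  shows "convergent (\<lambda>k. inner (x k) (v - u))"
proof -
  define K where "K = ((\<alpha> - 1) * norm u)\<^sup>2 / 2 - ((\<alpha> - 1) * norm v)\<^sup>2 / 2"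
  define s where "s = (\<lambda>k. inner (x k) (v - u))"
  \<comment> \<open>The squares of \<open>q\<close> cancel as well, and
    \<open>inner q (v - u)\<close> is the combination of \<open>s\<close> and its increments treated
    in \<open>tendsto_from_increments\<close>, with constant \<open>\<alpha> - 1\<close>.\<close>
  have eq: "real k * (s (Suc k) - s k) + (\<alpha> - 1) * s (Suc k)
      = (energy (Suc k) u - energy (Suc k) v - K) / (\<alpha> - 1)" for k
  proof -
    define q where "q = real k *\<^sub>R (x (Suc k) - x k) + (\<alpha> - 1) *\<^sub>R x (Suc k)"
    have vel: "velocity (Suc k) z = q - (\<alpha> - 1) *\<^sub>R z" for z
      by (simp add: velocity_def q_def algebra_simps)
    have norm: "(norm (q - (\<alpha> - 1) *\<^sub>R z))\<^sup>2 = (norm q)\<^sup>2 - 2 * (\<alpha> - 1) * inner q z + ((\<alpha> - 1) * norm z)\<^sup>2" for z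
      by (simp only: power_mult_distrib power2_norm_eq_inner)
        (simp add: inner_diff_left inner_diff_right inner_commute power2_eq_square algebra_simps)
    then have "energy (Suc k) u - energy (Suc k) v = (\<alpha> - 1) * inner q (v - u) + K"
      using max_gap_cong[of F u v "x (Suc k)"] \<open>F u = F v\<close> unfolding energy_def vel norm
      by (simp add: K_def inner_diff_right algebra_simps diff_divide_distrib add_divide_distrib)
    then have "inner q (v - u) = (energy (Suc k) u - energy (Suc k) v - K) / (\<alpha> - 1)"
      using alpha_ge by (simp add: field_simps)
    then show ?thesis
      by (simp add: s_def q_def inner_add_left inner_diff_left)
  qed
  have "convergent (\<lambda>k. (energy (Suc k) u - energy (Suc k) v - K) / (\<alpha> - 1))"
    by (simp only: divide_inverse)
      (intro convergent_mult convergent_diff convergent_const u v)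
  then obtain l where "(\<lambda>k. real k * (s (Suc k) - s k) + (\<alpha> - 1) * s (Suc k)) \<longlonglongrightarrow> l"
    unfolding eq by (auto simp: convergent_def)
  then have "s \<longlonglongrightarrow> l / (\<alpha> - 1)"
    using alpha_ge by (intro tendsto_from_increments) auto
  then show ?thesis
    unfolding s_def by (auto simp: convergent_def)
qed

lemma convergent_x: "convergent x"
proof (rule convergent_if_unique_cluster_point[OF bounded_x])
  fix r s :: "nat \<Rightarrow> nat" and u v
  assume r: "strict_mono r" "(x \<circ> r) \<longlonglongrightarrow> u" and s: "strict_mono s" "(x \<circ> s) \<longlonglongrightarrow> v"
  obtain L where L: "(\<lambda>k. F (x k)) \<longlonglongrightarrow> L"
    "\<And>k i. k \<ge> 1 \<Longrightarrow> L $ i - kinetic k \<le> F (x (Suc k)) $ i"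
    by (rule F_limit) blast
  \<comment> \<open>By continuity all cluster points share the value \<open>L\<close>, which gives
    both the equality of values and the lower bound required of a reference point.\<close>
  have F_cluster: "F w = L" if "strict_mono t" "(x \<circ> t) \<longlonglongrightarrow> w" for t w
  proof (rule LIMSEQ_unique)
    show "(\<lambda>k. F (x (t k))) \<longlonglongrightarrow> F w"
      using continuous_on_tendsto_compose[OF continuous_F[of UNIV] that(2)] by simp
    show "(\<lambda>k. F (x (t k))) \<longlonglongrightarrow> L"
      using LIMSEQ_subseq_LIMSEQ[OF L(1) that(1)] by (simp add: o_def)
  qed
  note Fu = F_cluster[OF r] and Fv = F_cluster[OF s]
  have "convergent (\<lambda>k. inner (x k) (v - u))"
    using Fu Fv L(2) by (intro inner_x_convergent energy_convergent) auto
  then obtain l where l: "(\<lambda>k. inner (x k) (v - u)) \<longlonglongrightarrow> l"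
    by (auto simp: convergent_def)
  have inner_cluster: "inner w (v - u) = l" if "strict_mono t" "(x \<circ> t) \<longlonglongrightarrow> w" for t w
  proof (rule LIMSEQ_unique)
    show "(\<lambda>k. inner ((x \<circ> t) k) (v - u)) \<longlonglongrightarrow> inner w (v - u)"
      by (intro tendsto_intros that(2))
    show "(\<lambda>k. inner ((x \<circ> t) k) (v - u)) \<longlonglongrightarrow> l"
      using LIMSEQ_subseq_LIMSEQ[OF l that(1)] by (simp add: o_def)
  qed
  have "inner (v - u) (v - u) = 0"
    using inner_cluster[OF r] inner_cluster[OF s] by (simp add: inner_diff_left)
  then show "u = v"
    by simp
qed

end

theorem theorem5p2:
  fixes F :: "real^'n \<Rightarrow> real^'m"
    and \<alpha> :: real
    and \<beta> :: "nat \<Rightarrow> real"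
    and x :: "nat \<Rightarrow> real^'n"
  assumes "\<And>i. convex_on UNIV (\<lambda>z. F z $ i)"
    and "\<And>i. lower_semicontinuous (\<lambda>z. F z $ i)"
    and "assumption_R F"
    and "\<alpha> \<ge> 3"
    and "\<beta> 1 > 0"
    and "mipp F \<alpha> \<beta> x"
    and "bounded (range x)"
    and "(\<forall>i. continuous_on UNIV (\<lambda>z. F z $ i)) \<or>
         (\<chi> i. lim (\<lambda>k. F (x k) $ i)) \<in> F ` pareto F"
  shows "\<exists>x'. x \<longlonglongrightarrow> x'"
proof -
  interpret mipp_sequence F \<alpha> \<beta> x
    using assms by unfold_locales auto
  show ?thesis
    using convergent_x by (simp add: convergent_def)
qed

end
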